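(* Let $p$ be a prime and let $x$ and $y$ be $p$-adic integers with $y\not\equiv 0\pmod p$. (i) We have $$\sum_{k=0}^{p-1}D_k(x,y)D_k(-1-x,y)\equiv(-1)^{\langle x\rangle_p}\pmod p.$$ If moreover $y\not\equiv 1\pmod p$, then $$\sum_{k=0}^{p-1}(1-y)^kD_k(x,y)D_k\left(x,\frac y{y-1}\right)\equiv(-1)^{\langle x\rangle_p}\pmod p.$$ (ii) Provided $p\neq 2$, we have $$\sum_{k=0}^{p-1}S_k(x,y)^2\equiv\begin{cases}\left(\frac{-1}{p}\right)\pmod p&\text{if } x\equiv-1/2\pmod p,\\ 0\pmod p&\text{otherwise}.\end{cases}$$
   Context: For $n\in\{0,1,2,\ldots\}$ and a variable $x$, $\binom{x}{k}=x(x-1)\cdots(x-k+1)/k!$. Define the polynomials $$D_n(x,y)=\sum_{k=0}^n\binom nk\binom xk y^k,\qquad S_n(x,y)=\sum_{k=0}^n\binom nk\binom xk\binom{-1-x}{k}y^k.$$ For a $p$-adic integer $x$, $\langle x\rangle_p$ denotes the least nonnegative integer $r$ with $x\equiv r\pmod p$. For $p$-adic numbers $a,b$, $a\equiv b\pmod{p^m}$ means $(a-b)/p^m$ is a $p$-adic integer. $\left(\frac{\cdot}{p}\right)$ is the Legendre symbol. *)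

theory Defs
  imports
    "HOL-Computational_Algebra.Polynomial_Factorial"
    "HOL-Number_Theory.Number_Theory"
    "Berlekamp_Zassenhaus.Finite_Field"
begin

text \<open>
  The prime \<open>p\<close> is the cardinality of a type of class \<^class>\<open>prime_card\<close>, so that the
  \<open>p\<close>-adic integers and the \<open>p\<close>-adic numbers are types.  The \<open>p\<close>-adic integers are the inverse
  limit of the rings of integers modulo \<open>p ^ n\<close>: the \<open>n\<close>-th entry of a coherent sequence is the
  representative in \<open>{0..<p ^ n}\<close> of the residue class modulo \<open>p ^ n\<close>.
\<close>

typedef (overloaded) ('p::prime_card) padic_int =
  "{f :: nat \<Rightarrow> int. \<forall>n. f n \<in> {0..<int CARD('p) ^ n} \<and>
                         f (Suc n) mod int CARD('p) ^ n = f n}"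
  morphisms padic_residue Abs_padic_int
  by (rule exI[of _ "\<lambda>_. 0"]) (use prime_card[where 'a = 'p] prime_gt_0_nat in auto)

setup_lifting type_definition_padic_int

lemma prime_card_power_pos: "0 < int CARD('p::prime_card) ^ n"
  using prime_gt_0_nat[OF prime_card[where 'a = 'p]] by simp

lemma mod_power_Suc_mod: "a mod (q::int) ^ Suc n mod q ^ n = a mod q ^ n"
  by (rule mod_mod_cancel) simp

instantiation padic_int :: (prime_card) comm_ring_1
begin

lift_definition zero_padic_int :: "'a padic_int" is "\<lambda>_. 0"
  by (simp add: prime_card_power_pos[where 'p = 'a, simplified])

lift_definition one_padic_int :: "'a padic_int" is "\<lambda>n. 1 mod int CARD('a) ^ n"
  using prime_card_power_pos[where 'p = 'a]
  by (simp add: mod_power_Suc_mod del: power_Suc)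

lift_definition plus_padic_int :: "'a padic_int \<Rightarrow> 'a padic_int \<Rightarrow> 'a padic_int"
  is "\<lambda>f g n. (f n + g n) mod int CARD('a) ^ n"
proof -
  fix f g :: "nat \<Rightarrow> int" and n :: nat
  assume f: "\<And>n. f n \<in> {0..<int CARD('a) ^ n} \<and> f (Suc n) mod int CARD('a) ^ n = f n"
    and g: "\<And>n. g n \<in> {0..<int CARD('a) ^ n} \<and> g (Suc n) mod int CARD('a) ^ n = g n"
  show "(f n + g n) mod int CARD('a) ^ n \<in> {0..<int CARD('a) ^ n} \<and>
      (f (Suc n) + g (Suc n)) mod int CARD('a) ^ Suc n mod int CARD('a) ^ n =
      (f n + g n) mod int CARD('a) ^ n"
    unfolding mod_power_Suc_mod using prime_card_power_pos[where 'p = 'a] f g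
    by (metis atLeastLessThan_iff mod_add_eq pos_mod_bound pos_mod_sign)
qed

lift_definition times_padic_int :: "'a padic_int \<Rightarrow> 'a padic_int \<Rightarrow> 'a padic_int"
  is "\<lambda>f g n. (f n * g n) mod int CARD('a) ^ n"
proof -
  fix f g :: "nat \<Rightarrow> int" and n :: nat
  assume f: "\<And>n. f n \<in> {0..<int CARD('a) ^ n} \<and> f (Suc n) mod int CARD('a) ^ n = f n"
    and g: "\<And>n. g n \<in> {0..<int CARD('a) ^ n} \<and> g (Suc n) mod int CARD('a) ^ n = g n"
  show "(f n * g n) mod int CARD('a) ^ n \<in> {0..<int CARD('a) ^ n} \<and>
      (f (Suc n) * g (Suc n)) mod int CARD('a) ^ Suc n mod int CARD('a) ^ n =
      (f n * g n) mod int CARD('a) ^ n"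
    unfolding mod_power_Suc_mod using prime_card_power_pos[where 'p = 'a] f g
    by (metis atLeastLessThan_iff mod_mult_eq pos_mod_bound pos_mod_sign)
qed

lift_definition uminus_padic_int :: "'a padic_int \<Rightarrow> 'a padic_int"
  is "\<lambda>f n. (- f n) mod int CARD('a) ^ n"
proof -
  fix f :: "nat \<Rightarrow> int" and n :: nat
  assume f: "\<And>n. f n \<in> {0..<int CARD('a) ^ n} \<and> f (Suc n) mod int CARD('a) ^ n = f n"
  show "(- f n) mod int CARD('a) ^ n \<in> {0..<int CARD('a) ^ n} \<and>
      (- f (Suc n)) mod int CARD('a) ^ Suc n mod int CARD('a) ^ n =
      (- f n) mod int CARD('a) ^ n"
    unfolding mod_power_Suc_mod using prime_card_power_pos[where 'p = 'a] f
    by (metis atLeastLessThan_iff mod_minus_eq pos_mod_bound pos_mod_sign)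
qed

definition minus_padic_int :: "'a padic_int \<Rightarrow> 'a padic_int \<Rightarrow> 'a padic_int"
  where "minus_padic_int x y = x + - y"

instance
proof
  fix a b c :: "'a padic_int"
  show "a + b + c = a + (b + c)"
    by transfer (simp add: mod_simps add.assoc)
  show "a + b = b + a"
    by transfer (simp add: add.commute)
  show "0 + a = a"
    by transfer auto
  show "- a + a = 0"
    by transfer (simp add: mod_simps)
  show "a - b = a + - b"
    by (rule minus_padic_int_def)
  show "a * b * c = a * (b * c)"
    by transfer (simp add: mod_simps mult.assoc)
  show "a * b = b * a"
    by transfer (simp add: mult.commute)
  show "1 * a = a"
    by transfer (auto simp add: mod_simps)
  show "(a + b) * c = a * c + b * c"
    by transfer (simp add: mod_simps distrib_right)
  show "(0 :: 'a padic_int) \<noteq> 1"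
  proof
    assume "(0 :: 'a padic_int) = 1"
    then have "padic_residue (0 :: 'a padic_int) 1 = padic_residue 1 1"
      by simp
    then show False
      using prime_gt_1_nat[OF prime_card[where 'a = 'a]]
      by (simp add: zero_padic_int.rep_eq one_padic_int.rep_eq)
  qed
qed

end

lemma padic_residue_mod:
  fixes x :: "'p::prime_card padic_int"
  shows "padic_residue x (n + m) mod int CARD('p) ^ n = padic_residue x n"
proof (induction m)
  case 0
  show ?case
    using padic_residue[of x] by auto
next
  case (Suc m)
  have "padic_residue x (n + Suc m) mod int CARD('p) ^ n =
        padic_residue x (Suc (n + m)) mod int CARD('p) ^ (n + m) mod int CARD('p) ^ n"
    by (simp add: mod_mod_cancel le_imp_power_dvd)
  also have "\<dots> = padic_residue x (n + m) mod int CARD('p) ^ n"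
    using padic_residue[of x] by auto
  finally show ?case
    using Suc.IH by simp
qed

lemma padic_residue_of_nat:
  "padic_residue (of_nat k :: 'p::prime_card padic_int) n = int k mod int CARD('p) ^ n"
  by (induction k)
    (simp_all add: zero_padic_int.rep_eq one_padic_int.rep_eq plus_padic_int.rep_eq mod_simps)

instance padic_int :: (prime_card) idom
proof
  fix a b :: "'a padic_int"
  let ?p = "int CARD('a)"
  assume "a \<noteq> 0" "b \<noteq> 0"
  then obtain m n where m: "padic_residue a m \<noteq> 0" and n: "padic_residue b n \<noteq> 0"
    by (metis zero_padic_int.rep_eq ext padic_residue_inject)
  define u v where "u = padic_residue a (m + n)" and "v = padic_residue b (n + m)"
  have u: "\<not> ?p ^ m dvd u" and v: "\<not> ?p ^ n dvd v"
    using m n padic_residue_mod[of a m n] padic_residue_mod[of b n m]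
    by (auto simp: u_def v_def mod_eq_0_iff_dvd)
  have p: "prime ?p"
    by (rule prime_card_int)
  have nz: "u \<noteq> 0" "v \<noteq> 0"
    using u v by auto
  have "multiplicity ?p u < m" "multiplicity ?p v < n"
    using u v nz p by (meson multiplicity_dvd' not_le)+
  then have "multiplicity ?p (u * v) < m + n"
    using nz p by (simp add: prime_elem_multiplicity_mult_distrib)
  then have "\<not> ?p ^ (m + n) dvd u * v"
    using nz p by (meson multiplicity_geI mult_eq_0_iff not_less prime_elem_not_unit prime_imp_prime_elem)
  then have "padic_residue (a * b) (m + n) \<noteq> 0"
    by (simp add: times_padic_int.rep_eq u_def v_def add.commute mod_eq_0_iff_dvd)
  then show "a * b \<noteq> 0"
    by (auto simp: zero_padic_int.rep_eq)
qed

instance padic_int :: (prime_card) ring_char_0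
proof
  show "inj (of_nat :: nat \<Rightarrow> 'a padic_int)"
  proof (rule injI)
    fix j k :: nat
    assume eq: "(of_nat j :: 'a padic_int) = of_nat k"
    let ?p = "CARD('a)" and ?n = "max j k"
    have "?n < ?p ^ ?n"
      using prime_gt_1_nat[OF prime_card[where 'a = 'a]] by (intro power_gt_expt) simp
    then have "int j < int ?p ^ ?n" "int k < int ?p ^ ?n"
      by (metis max_less_iff_conj of_nat_less_iff of_nat_power le_less_trans max.cobounded1 max.cobounded2)+
    moreover have "int j mod int ?p ^ ?n = int k mod int ?p ^ ?n"
      using eq by (metis padic_residue_of_nat)
    ultimately show "j = k"
      by simp
  qed
qed

instance fract :: ("{idom, ring_char_0}") field_char_0
proof
  have "of_nat k = to_fract (of_nat k :: 'a)" for k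
    by (induction k) simp_all
  then show "inj (of_nat :: nat \<Rightarrow> 'a fract)"
    by (auto intro!: injI)
qed

type_synonym 'p padic = "'p padic_int fract"

definition padic_Ints :: "'p::prime_card padic set"
  where "padic_Ints = range to_fract"

text \<open>The congruence \<open>a \<equiv> b\<close> modulo \<open>p ^ m\<close> of \<open>p\<close>-adic numbers.\<close>

definition padic_cong :: "nat \<Rightarrow> 'p::prime_card padic \<Rightarrow> 'p padic \<Rightarrow> bool"
  where "padic_cong m a b \<longleftrightarrow> (a - b) / of_nat CARD('p) ^ m \<in> padic_Ints"

definition least_residue :: "'p::prime_card padic \<Rightarrow> nat"
  where "least_residue x = (LEAST r. padic_cong 1 x (of_nat r))"

definition D_poly :: "nat \<Rightarrow> 'a::field_char_0 \<Rightarrow> 'a \<Rightarrow> 'a"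
  where "D_poly n x y = (\<Sum>k=0..n. of_nat (n choose k) * (x gchoose k) * y ^ k)"

definition S_poly :: "nat \<Rightarrow> 'a::field_char_0 \<Rightarrow> 'a \<Rightarrow> 'a"
  where "S_poly n x y =
    (\<Sum>k=0..n. of_nat (n choose k) * (x gchoose k) * ((- 1 - x) gchoose k) * y ^ k)"

end

theory Submission
  imports Defs "HOL-Computational_Algebra.Formal_Power_Series"
begin

text \<open>
  Modulo \<open>p\<close> one may replace \<open>x\<close> and \<open>- 1 - x\<close> by natural numbers \<open>r\<close> and \<open>s\<close> with
  \<open>r + s = p - 1\<close>, and \<open>y\<close> by a natural number prime to \<open>p\<close>.  Then \<open>D_n(r, y)\<close> is an integral
  combination of the \<open>n choose j\<close> with \<open>j \<le> r\<close>, while \<open>S_n(r, y)\<close> only involves \<open>j \<le> min r s\<close>.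
  Since the sum of \<open>n choose m\<close> over \<open>n < p\<close> is \<open>p choose (m + 1)\<close>, expanding
  \<open>(n choose j) * (n choose k)\<close> in the basis \<open>n choose m\<close> shows that only the terms with
  \<open>j + k = p - 1\<close> survive; they contribute \<open>(p - 1) choose j\<close>, that is \<open>(- 1) ^ j\<close>, and
  \<open>y ^ (p - 1)\<close> is \<open>1\<close>.  The second sum in (i) equals the first one termwise, by the Pfaff
  transformation of the terminating hypergeometric series \<open>D_n\<close>.
\<close>

section \<open>Sums of products of binomial coefficients modulo a prime\<close>

text \<open>Vandermonde's convolution for \<open>n = (n - j) + j\<close> expands
  \<open>n choose k\<close>. Each product \<open>(n choose j) * ((n - j) choose i)\<close> then
  becomes \<open>((j + i) choose j) * (n choose (j + i))\<close>. For \<open>j > n\<close> both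
  sides vanish.\<close>

lemma binomial_mult_binomial:
  "(n choose j) * (n choose k) =
     (\<Sum>i\<le>k. (j choose (k - i)) * ((j + i) choose j) * (n choose (j + i)))"
proof (cases "j \<le> n")
  case True
  have "(n choose k) = (\<Sum>i\<le>k. ((n - j) choose i) * (j choose (k - i)))"
    using vandermonde[of "n - j" j k] True by simp
  moreover have "(n choose j) * ((n - j) choose i) = ((j + i) choose j) * (n choose (j + i))" for i
  proof (cases "j + i \<le> n")
    case True
    then show ?thesis
      using choose_mult[of j "j + i" n] by (simp add: mult.commute)
  next
    case False
    then have "n - j < i" using \<open>j \<le> n\<close> by linarith
    with False show ?thesis by (simp add: binomial_eq_0)
  qed
  ultimately show ?thesis
    by (simp add: sum_distrib_left) (intro sum.cong refl, metis mult.assoc mult.commute)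
qed (simp add: binomial_eq_0)

text \<open>By Pascal's rule, neighbouring entries of row \<open>p - 1\<close> add up to an inner
  entry of row \<open>p\<close>, which is divisible by \<open>p\<close>; hence each entry is minus
  its predecessor.\<close>

lemma binomial_prime_minus_one_cong:
  fixes p :: nat
  assumes p: "prime p" and "j < p"
  shows "[int ((p - 1) choose j) = (- 1) ^ j] (mod int p)"
  using \<open>j < p\<close>
proof (induction j)
  case (Suc j)
  have "p choose Suc j = ((p - 1) choose j) + ((p - 1) choose Suc j)"
    using choose_reduce_nat[of p "Suc j"] Suc.prems by simp
  moreover have "p dvd p choose Suc j"
    using Suc.prems p by (intro dvd_choose_prime) auto
  ultimately have "[int ((p - 1) choose j) + int ((p - 1) choose Suc j) = 0] (mod int p)"
    by (metis cong_0_iff of_nat_add of_nat_dvd_iff)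
  moreover have "[int ((p - 1) choose j) = (- 1) ^ j] (mod int p)"
    using Suc by simp
  ultimately have
    "[int ((p - 1) choose j) + int ((p - 1) choose Suc j) - int ((p - 1) choose j) = 0 - (- 1) ^ j]
       (mod int p)"
    by (rule cong_diff)
  then show ?case by simp
qed simp

text \<open>The bound on \<open>j + k\<close> keeps the lower index in
  \<open>p choose Suc (j + i)\<close> between \<open>1\<close> and \<open>p\<close>, so
  \<open>p\<close> divides this coefficient unless \<open>j + i = p - 1\<close>.\<close>

lemma sum_binomial_mult_binomial_cong:
  fixes p :: nat
  assumes p: "prime p" and jk: "j + k \<le> p - 1"
  shows "[(\<Sum>n=0..p - 1. int (n choose j) * int (n choose k)) =
           (if j + k = p - 1 then (- 1) ^ j else 0)] (mod int p)"
proof -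
  have p1: "p > 1" using p by (rule prime_gt_1_nat)
  \<comment> \<open>Hockey-stick identity: summing a column of Pascal's triangle over all rows below
    \<open>p\<close> lands in row \<open>p\<close>.\<close>
  have col: "(\<Sum>n=0..p - 1. (n choose m)) = p choose Suc m" for m
    using sum_choose_upper[of m "p - 1"] p1 by (simp add: atMost_atLeast0)
  have "(\<Sum>n=0..p - 1. int (n choose j) * int (n choose k)) =
        int (\<Sum>n=0..p - 1. (n choose j) * (n choose k))"
    by simp
  also have "(\<Sum>n=0..p - 1. (n choose j) * (n choose k)) =
     (\<Sum>i\<le>k. (j choose (k - i)) * ((j + i) choose j) * (\<Sum>n=0..p - 1. (n choose (j + i))))"
    unfolding binomial_mult_binomial sum_distrib_left by (rule sum.swap)
  also have "\<dots> = (\<Sum>i\<le>k. (j choose (k - i)) * ((j + i) choose j) * (p choose Suc (j + i)))"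
    by (simp only: col)
  \<comment> \<open>The term \<open>i = k\<close> is split off: there
    \<open>j choose (k - i)\<close> is \<open>1\<close>, and it is the only term whose lower index
    can reach \<open>p\<close>.\<close>
  also have "\<dots> = (\<Sum>i<k. (j choose (k - i)) * ((j + i) choose j) * (p choose Suc (j + i)))
                 + ((j + k) choose j) * (p choose Suc (j + k))"
    by (simp add: lessThan_Suc_atMost[symmetric])
  finally have eq: "(\<Sum>n=0..p - 1. int (n choose j) * int (n choose k)) =
      int (\<Sum>i<k. (j choose (k - i)) * ((j + i) choose j) * (p choose Suc (j + i)))
       + int (((j + k) choose j) * (p choose Suc (j + k)))" by simp
  have "p dvd (\<Sum>i<k. (j choose (k - i)) * ((j + i) choose j) * (p choose Suc (j + i)))"
  proof (intro dvd_sum dvd_mult)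
    fix i assume "i \<in> {..<k}"
    then show "p dvd p choose Suc (j + i)"
      using p jk p1 by (intro dvd_choose_prime) auto
  qed
  then have 1: "[int (\<Sum>i<k. (j choose (k - i)) * ((j + i) choose j) * (p choose Suc (j + i))) = 0]
      (mod int p)"
    by (simp only: cong_0_iff of_nat_dvd_iff)
  have 2: "[int (((j + k) choose j) * (p choose Suc (j + k))) =
           (if j + k = p - 1 then (- 1) ^ j else 0)] (mod int p)"
  proof (cases "j + k = p - 1")
    case True
    then show ?thesis
      using binomial_prime_minus_one_cong[OF p, of j] p1 by simp
  next
    case False
    then have "p dvd p choose Suc (j + k)"
      using p jk by (intro dvd_choose_prime) auto
    then have "p dvd ((j + k) choose j) * (p choose Suc (j + k))"
      by (rule dvd_mult)
    then show ?thesis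
      using False by (simp only: cong_0_iff of_nat_dvd_iff if_False)
  qed
  show ?thesis
    unfolding eq using cong_add[OF 1 2] by simp
qed

text \<open>Both factors are polynomials in \<open>n\<close>, of degrees at most \<open>u\<close>
  and \<open>v\<close>, written in the binomial basis. By bilinearity the sum over \<open>n\<close>
  sees at most the product of their top coefficients.\<close>

lemma sum_binomial_combinations_cong:
  fixes p :: nat and a b :: "nat \<Rightarrow> int"
  assumes p: "prime p" and uv: "u + v \<le> p - 1"
  shows "[(\<Sum>n=0..p - 1. (\<Sum>j\<le>u. a j * int (n choose j)) * (\<Sum>k\<le>v. b k * int (n choose k))) =
           (if u + v = p - 1 then (- 1) ^ u * a u * b v else 0)] (mod int p)"
proof -
  have "(\<Sum>n=0..p - 1. (\<Sum>j\<le>u. a j * int (n choose j)) * (\<Sum>k\<le>v. b k * int (n choose k))) =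
        (\<Sum>n=0..p - 1. \<Sum>j\<le>u. \<Sum>k\<le>v. a j * b k * (int (n choose j) * int (n choose k)))"
    by (simp add: sum_product mult.assoc mult.left_commute)
  also have "\<dots> = (\<Sum>j\<le>u. \<Sum>n=0..p - 1. \<Sum>k\<le>v. a j * b k * (int (n choose j) * int (n choose k)))"
    by (rule sum.swap)
  also have "\<dots> = (\<Sum>j\<le>u. \<Sum>k\<le>v. \<Sum>n=0..p - 1. a j * b k * (int (n choose j) * int (n choose k)))"
    by (intro sum.cong refl sum.swap)
  also have "\<dots> = (\<Sum>j\<le>u. \<Sum>k\<le>v. a j * b k * (\<Sum>n=0..p - 1. int (n choose j) * int (n choose k)))"
    by (simp add: sum_distrib_left)
  also have "[\<dots> = (\<Sum>j\<le>u. \<Sum>k\<le>v. a j * b k * (if j + k = p - 1 then (- 1) ^ j else 0))] (mod int p)"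
    using uv by (intro cong_sum cong_mult cong_refl sum_binomial_mult_binomial_cong p) auto
  \<comment> \<open>Within \<open>j \<le> u\<close> and \<open>k \<le> v\<close>, the equation
    \<open>j + k = p - 1\<close> can hold only at the corner \<open>j = u\<close>,
    \<open>k = v\<close>.\<close>
  also have "(\<Sum>j\<le>u. \<Sum>k\<le>v. a j * b k * (if j + k = p - 1 then (- 1) ^ j else 0)) =
      (\<Sum>j\<le>u. \<Sum>k\<le>v. if j = u \<and> k = v
         then (if u + v = p - 1 then (- 1) ^ u * a u * b v else 0) else 0)"
    using uv by (intro sum.cong refl) auto
  also have "\<dots> = (\<Sum>j\<le>u. if j = u
         then (if u + v = p - 1 then (- 1) ^ u * a u * b v else 0) else 0)"
    by (intro sum.cong refl) (simp add: sum.delta')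
  also have "\<dots> = (if u + v = p - 1 then (- 1) ^ u * a u * b v else 0)"
    by (simp add: sum.delta')
  finally show ?thesis .
qed

text \<open>The top coefficients are \<open>t ^ r\<close> and \<open>t ^ s\<close>; their product
  \<open>t ^ (p - 1)\<close> is \<open>1\<close> modulo \<open>p\<close> by Fermat.\<close>

lemma sum_int_D_cong:
  fixes p r s t :: nat
  assumes p: "prime p" and rs: "r + s = p - 1" and t: "\<not> p dvd t"
  shows "[(\<Sum>n=0..p - 1. (\<Sum>j\<le>r. int (r choose j) * int t ^ j * int (n choose j)) *
                          (\<Sum>k\<le>s. int (s choose k) * int t ^ k * int (n choose k))) = (- 1) ^ r]
         (mod int p)"
proof -
  have "[t ^ (p - 1) = 1] (mod p)"
    using p t by (rule fermat_theorem)
  then have "[int t ^ (p - 1) = 1] (mod int p)"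
    by (metis cong_int_iff of_nat_1 of_nat_power)
  then have "[(- 1) ^ r * int t ^ (p - 1) = (- 1) ^ r * 1] (mod int p)"
    by (intro cong_mult cong_refl)
  moreover have "int t ^ (p - 1) = int t ^ r * int t ^ s"
    unfolding rs[symmetric] by (rule power_add)
  ultimately have "[(- 1) ^ r * int t ^ r * int t ^ s = (- 1) ^ r] (mod int p)"
    by (simp add: mult.assoc)
  with sum_binomial_combinations_cong[OF p, of r s "\<lambda>j. int (r choose j) * int t ^ j"
      "\<lambda>k. int (s choose k) * int t ^ k"] rs
  show ?thesis
    by (auto intro: cong_trans)
qed

text \<open>With \<open>m = min r s\<close> one has \<open>2 * m \<le> r + s = p - 1\<close>, with
  equality exactly for \<open>r = s\<close>. In that case the top coefficient is
  \<open>t ^ m\<close>, its square is \<open>1\<close> by Fermat, and the sign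
  \<open>(- 1) ^ m\<close> with \<open>m = (p - 1) / 2\<close> is the Legendre symbol by Euler's
  criterion.\<close>

lemma sum_int_S_square_cong:
  fixes p r s t :: nat
  assumes p: "prime p" and "p \<noteq> 2" and rs: "r + s = p - 1" and t: "\<not> p dvd t"
  shows "[(\<Sum>n=0..p - 1.
             (\<Sum>j\<le>min r s. int (r choose j) * int (s choose j) * int t ^ j * int (n choose j))\<^sup>2) =
           (if r = s then Legendre (- 1) (int p) else 0)] (mod int p)"
proof -
  define a where "a j = int (r choose j) * int (s choose j) * int t ^ j" for j
  define m where "m = min r s"
  have main: "[(\<Sum>n=0..p - 1. (\<Sum>j\<le>m. a j * int (n choose j))\<^sup>2) =
           (if m + m = p - 1 then (- 1) ^ m * a m * a m else 0)] (mod int p)"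
    unfolding power2_eq_square
    by (rule sum_binomial_combinations_cong[OF p]) (use rs in \<open>auto simp: m_def\<close>)
  have mm: "m + m = p - 1 \<longleftrightarrow> r = s"
    using rs by (auto simp: m_def min_def)
  have "[(if m + m = p - 1 then (- 1) ^ m * a m * a m else 0) =
         (if r = s then Legendre (- 1) (int p) else 0)] (mod int p)"
  proof (cases "r = s")
    case True
    then have pm: "p - 1 = m + m" and am: "a m = int t ^ m"
      using rs by (simp_all add: a_def m_def)
    have p2: "p > 2"
      using p \<open>p \<noteq> 2\<close> prime_ge_2_nat[of p] by simp
    have "[t ^ (p - 1) = 1] (mod p)"
      using p t by (rule fermat_theorem)
    then have "[int t ^ (p - 1) = 1] (mod int p)"
      by (metis cong_int_iff of_nat_1 of_nat_power)
    then have "[(- 1) ^ m * int t ^ (p - 1) = (- 1) ^ m * 1] (mod int p)"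
      by (intro cong_mult cong_refl)
    then have "[(- 1) ^ m * a m * a m = (- 1) ^ m] (mod int p)"
      unfolding am pm by (simp add: power_add mult.assoc)
    moreover have "[Legendre (- 1) (int p) = (- 1) ^ m] (mod int p)"
      using euler_criterion[OF p p2, of "- 1"] pm by (simp flip: mult_2)
    ultimately show ?thesis
      using mm True by (auto intro: cong_trans cong_sym)
  qed (use mm in simp)
  with main have "[(\<Sum>n=0..p - 1. (\<Sum>j\<le>m. a j * int (n choose j))\<^sup>2) =
      (if r = s then Legendre (- 1) (int p) else 0)] (mod int p)"
    by (rule cong_trans)
  then show ?thesis
    by (simp only: a_def m_def)
qed

section \<open>Identities for the two families of polynomials\<close>

text \<open>Terms with \<open>j > n\<close> or \<open>j > r\<close> vanish, so the range can be
  extended to \<open>max n r\<close> and cut down to \<open>r\<close>. The new range no longer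
  depends on \<open>n\<close>, as summation over \<open>n\<close> requires.\<close>

lemma D_poly_of_nat:
  "D_poly n (of_nat r :: 'a::field_char_0) (of_nat t) =
     of_int (\<Sum>j\<le>r. int (r choose j) * int t ^ j * int (n choose j))"
proof -
  have "D_poly n (of_nat r :: 'a) (of_nat t) =
      (\<Sum>j\<le>n. of_nat ((r choose j) * t ^ j * (n choose j)))"
    unfolding D_poly_def binomial_gbinomial[symmetric] atMost_atLeast0
    by (intro sum.cong refl) (simp add: mult_ac)
  also have "\<dots> = (\<Sum>j\<le>max n r. of_nat ((r choose j) * t ^ j * (n choose j)))"
    by (intro sum.mono_neutral_left) auto
  also have "\<dots> = (\<Sum>j\<le>r. of_nat ((r choose j) * t ^ j * (n choose j)))"
    by (intro sum.mono_neutral_right) auto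
  finally show ?thesis by simp
qed

text \<open>The grouping matches \<open>sum_binomial_products_restrict\<close>. For
  \<open>x = r\<close> the number \<open>- 1 - x\<close> is only congruent to \<open>s\<close>, not
  equal to it, so the two generalized binomials have to be replaced separately by
  congruences.\<close>

lemma S_poly_eq_combination:
  fixes x y :: "'a::field_char_0"
  shows "S_poly n x y =
     (\<Sum>k=0..n. of_nat (n choose k) * ((x gchoose k) * ((- 1 - x) gchoose k) * y ^ k))"
  by (simp add: S_poly_def mult.assoc)

lemma sum_binomial_products_restrict:
  "(\<Sum>k=0..n. of_nat (n choose k) * (of_nat (r choose k) * of_nat (s choose k) * of_nat t ^ k)) =
     (of_int (\<Sum>j\<le>min r s. int (r choose j) * int (s choose j) * int t ^ j * int (n choose j))
        :: 'a::field_char_0)"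
proof -
  have "(\<Sum>k=0..n. of_nat (n choose k) * (of_nat (r choose k) * of_nat (s choose k) * of_nat t ^ k)) =
      (\<Sum>j\<le>n. of_nat ((r choose j) * (s choose j) * t ^ j * (n choose j)) :: 'a)"
    unfolding atMost_atLeast0 by (intro sum.cong refl) (simp add: mult_ac)
  also have "\<dots> = (\<Sum>j\<le>max n (min r s). of_nat ((r choose j) * (s choose j) * t ^ j * (n choose j)))"
    by (intro sum.mono_neutral_left) auto
  also have "\<dots> = (\<Sum>j\<le>min r s. of_nat ((r choose j) * (s choose j) * t ^ j * (n choose j)))"
    by (intro sum.mono_neutral_right) (auto simp: min_def split: if_splits)
  finally show ?thesis by simp
qed

text \<open>Vandermonde's convolution gives \<open>(x + m) gchoose m\<close>, and negating the upper
  index turns this into the right-hand side.\<close>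

lemma sum_binomial_gbinomial:
  fixes x :: "'a::field_char_0"
  shows "(\<Sum>k\<le>m. of_nat (m choose k) * (x gchoose k)) = (- 1) ^ m * ((- 1 - x) gchoose m)"
proof -
  have "(\<Sum>k\<le>m. of_nat (m choose k) * (x gchoose k)) =
        (\<Sum>k\<le>m. (x gchoose k) * (of_nat m gchoose (m - k)))"
    by (intro sum.cong refl) (simp add: binomial_gbinomial[symmetric] binomial_symmetric[symmetric] mult.commute)
  also have "\<dots> = (x + of_nat m) gchoose m"
    by (simp add: gbinomial_Vandermonde atMost_atLeast0)
  also have "\<dots> = (- 1) ^ m * ((- 1 - x) gchoose m)"
  proof -
    have "of_nat m - (x + of_nat m) - 1 = - 1 - x" by simp
    then show ?thesis
      using gbinomial_negated_upper[of "x + of_nat m" m] by (simp only:)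
  qed
  finally show ?thesis .
qed

text \<open>Expanding \<open>(1 - y) ^ (n - k)\<close> in powers of \<open>- y\<close> and
  collecting the coefficient of \<open>(- y) ^ m\<close> leaves the inner sum evaluated in
  \<open>sum_binomial_gbinomial\<close>.\<close>

lemma D_poly_Pfaff:
  fixes x y :: "'a::field_char_0"
  assumes "y \<noteq> 1"
  shows "(1 - y) ^ n * D_poly n x (y / (y - 1)) = D_poly n (- 1 - x) y"
proof -
  have "(1 - y) ^ n * D_poly n x (y / (y - 1)) =
      (\<Sum>k\<le>n. of_nat (n choose k) * (x gchoose k) * (- y) ^ k * (1 - y) ^ (n - k))"
    unfolding D_poly_def sum_distrib_left atMost_atLeast0
  proof (intro sum.cong refl)
    fix k assume "k \<in> {0..n}"
    then have split: "(1 - y) ^ n = (1 - y) ^ k * (1 - y) ^ (n - k)"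
      by (simp flip: power_add)
    \<comment> \<open>Since \<open>y / (y - 1) = - y / (1 - y)\<close>, the factor
      \<open>(1 - y) ^ k\<close> clears the denominator.\<close>
    have neg: "(- y) ^ k = (1 - y) ^ k * (y / (y - 1)) ^ k"
      using assms by (simp flip: power_mult_distrib add: field_simps)
    show "(1 - y) ^ n * (of_nat (n choose k) * (x gchoose k) * (y / (y - 1)) ^ k) =
        of_nat (n choose k) * (x gchoose k) * (- y) ^ k * (1 - y) ^ (n - k)"
      unfolding split neg by (simp only: mult_ac)
  qed
  also have "\<dots> = (\<Sum>k\<le>n. \<Sum>m\<in>{k..n}. of_nat ((n choose m) * (m choose k)) * (x gchoose k) * (- y) ^ m)"
  proof (intro sum.cong refl)
    fix k assume "k \<in> {..n}"
    have "(1 - y) ^ (n - k) = (- y + 1) ^ (n - k)" by simp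
    also have "\<dots> = (\<Sum>i\<le>n - k. of_nat ((n - k) choose i) * (- y) ^ i)"
      by (subst binomial_ring) simp
    also have "\<dots> = (\<Sum>m\<in>{k..n}. of_nat ((n - k) choose (m - k)) * (- y) ^ (m - k))"
      by (rule sum.reindex_bij_witness[of _ "\<lambda>m. m - k" "\<lambda>i. i + k"]) (use \<open>k \<in> {..n}\<close> in auto)
    finally have *: "(1 - y) ^ (n - k) =
      (\<Sum>m\<in>{k..n}. of_nat ((n - k) choose (m - k)) * (- y) ^ (m - k))" .
    show "of_nat (n choose k) * (x gchoose k) * (- y) ^ k * (1 - y) ^ (n - k) =
       (\<Sum>m\<in>{k..n}. of_nat ((n choose m) * (m choose k)) * (x gchoose k) * (- y) ^ m)"
      unfolding * sum_distrib_left
    proof (intro sum.cong refl)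
      fix m assume "m \<in> {k..n}"
      then have "(n choose m) * (m choose k) = (n choose k) * ((n - k) choose (m - k))"
        by (intro choose_mult) auto
      moreover have "(- y) ^ m = (- y) ^ k * (- y) ^ (m - k)"
        using \<open>m \<in> {k..n}\<close> by (simp flip: power_add)
      ultimately show "of_nat (n choose k) * (x gchoose k) * (- y) ^ k *
          (of_nat ((n - k) choose (m - k)) * (- y) ^ (m - k)) =
          of_nat ((n choose m) * (m choose k)) * (x gchoose k) * (- y) ^ m"
        by (simp only: of_nat_mult mult_ac)
    qed
  qed
  \<comment> \<open>The order of summation over the triangle \<open>k \<le> m \<le> n\<close> is
    exchanged.\<close>
  also have "\<dots> = (\<Sum>m\<le>n. \<Sum>k\<le>m. of_nat ((n choose m) * (m choose k)) * (x gchoose k) * (- y) ^ m)"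
    by (subst sum.Sigma, simp, simp, subst sum.Sigma, simp, simp,
        rule sum.reindex_bij_witness[of _ prod.swap prod.swap]) auto
  also have "\<dots> = (\<Sum>m\<le>n. of_nat (n choose m) * (- y) ^ m *
                      (\<Sum>k\<le>m. of_nat (m choose k) * (x gchoose k)))"
    by (simp add: sum_distrib_left mult_ac)
  also have "\<dots> = D_poly n (- 1 - x) y"
    unfolding sum_binomial_gbinomial unfolding D_poly_def atMost_atLeast0
  proof (intro sum.cong refl)
    fix m
    have neg: "y ^ m = (- y) ^ m * (- 1) ^ m"
      by (simp flip: power_mult_distrib)
    show "of_nat (n choose m) * (- y) ^ m * ((- 1) ^ m * (- 1 - x gchoose m)) =
        of_nat (n choose m) * (- 1 - x gchoose m) * y ^ m"
      unfolding neg by (simp only: mult_ac)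
  qed
  finally show ?thesis .
qed

section \<open>Congruences of \<open>p\<close>-adic integers modulo \<open>p\<close>\<close>

lemma padic_Ints_add: "a \<in> padic_Ints \<Longrightarrow> b \<in> padic_Ints \<Longrightarrow> a + b \<in> padic_Ints"
  unfolding padic_Ints_def by (auto simp flip: to_fract_add)

lemma padic_Ints_mult: "a \<in> padic_Ints \<Longrightarrow> b \<in> padic_Ints \<Longrightarrow> a * b \<in> padic_Ints"
  unfolding padic_Ints_def by (auto simp flip: to_fract_mult)

lemma padic_Ints_uminus: "a \<in> padic_Ints \<Longrightarrow> - a \<in> padic_Ints"
  unfolding padic_Ints_def by (auto simp flip: to_fract_uminus)

lemma padic_Ints_diff: "a \<in> padic_Ints \<Longrightarrow> b \<in> padic_Ints \<Longrightarrow> a - b \<in> padic_Ints"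
  unfolding padic_Ints_def by (auto simp flip: to_fract_diff)

lemma padic_Ints_0 [simp]: "0 \<in> padic_Ints"
  unfolding padic_Ints_def by (metis rangeI to_fract_0)

lemma padic_Ints_1 [simp]: "1 \<in> padic_Ints"
  unfolding padic_Ints_def by (metis rangeI to_fract_1)

lemma padic_Ints_of_nat [simp]: "of_nat n \<in> padic_Ints"
  by (induction n) (simp_all add: padic_Ints_add)

lemma padic_Ints_of_int [simp]: "of_int n \<in> padic_Ints"
  by (cases n rule: int_cases2) (simp_all add: padic_Ints_uminus)

lemma padic_Ints_power: "a \<in> padic_Ints \<Longrightarrow> a ^ n \<in> padic_Ints"
  by (induction n) (simp_all add: padic_Ints_mult)

lemma padic_Ints_sum: "(\<And>i. i \<in> A \<Longrightarrow> f i \<in> padic_Ints) \<Longrightarrow> sum f A \<in> padic_Ints"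
  by (induction A rule: infinite_finite_induct) (auto intro: padic_Ints_add)

lemma padic_Ints_prod: "(\<And>i. i \<in> A \<Longrightarrow> f i \<in> padic_Ints) \<Longrightarrow> prod f A \<in> padic_Ints"
  by (induction A rule: infinite_finite_induct) (auto intro: padic_Ints_mult)

section \<open>Calculation rules for congruences modulo \<open>p\<close>\<close>

lemma of_nat_card_padic_neq_0: "(of_nat CARD('p) :: 'p::prime_card padic) \<noteq> 0"
  using prime_gt_0_nat[OF prime_card[where 'a = 'p]] by simp

text \<open>Clearing the nonzero denominator yields an integral witness \<open>c\<close>, with which
  the rules below compute.\<close>

lemma padic_cong_1_iff:
  "padic_cong 1 a (b :: 'p::prime_card padic) \<longleftrightarrow> (\<exists>c\<in>padic_Ints. a - b = of_nat CARD('p) * c)"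
proof -
  have "(a - b) / of_nat CARD('p) = c \<longleftrightarrow> a - b = of_nat CARD('p) * c" for c
    using of_nat_card_padic_neq_0[where 'p = 'p] by (auto simp: field_simps)
  then show ?thesis
    unfolding padic_cong_def power_one_right by metis
qed

lemma padic_cong_refl: "padic_cong 1 a a"
  unfolding padic_cong_1_iff by (rule bexI[of _ 0]) auto

lemma padic_cong_sym:
  assumes "padic_cong 1 a b" shows "padic_cong 1 b a"
proof -
  from assms obtain c where c: "c \<in> padic_Ints" "a - b = of_nat CARD('a) * c"
    unfolding padic_cong_1_iff by blast
  then have "b - a = of_nat CARD('a) * - c"
    by (metis minus_diff_eq mult_minus_right)
  with c(1) show ?thesis
    unfolding padic_cong_1_iff by (blast intro: padic_Ints_uminus)
qed

lemma padic_cong_add: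
  assumes "padic_cong 1 a b" "padic_cong 1 c d"
  shows "padic_cong 1 (a + c) (b + d)"
proof -
  from assms obtain u v where "u \<in> padic_Ints" "a - b = of_nat CARD('a) * u"
    "v \<in> padic_Ints" "c - d = of_nat CARD('a) * v"
    unfolding padic_cong_1_iff by blast
  moreover from this have "a + c - (b + d) = of_nat CARD('a) * (u + v)"
    by (simp add: algebra_simps)
  ultimately show ?thesis
    unfolding padic_cong_1_iff by (blast intro: padic_Ints_add)
qed

lemma padic_cong_trans [trans]:
  assumes "padic_cong 1 a b" "padic_cong 1 b c"
  shows "padic_cong 1 a c"
proof -
  from assms obtain u v where "u \<in> padic_Ints" "a - b = of_nat CARD('a) * u"
    "v \<in> padic_Ints" "b - c = of_nat CARD('a) * v"
    unfolding padic_cong_1_iff by blast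
  moreover from this have "a - c = of_nat CARD('a) * (u + v)"
    by (simp add: algebra_simps)
  ultimately show ?thesis
    unfolding padic_cong_1_iff by (blast intro: padic_Ints_add)
qed

text \<open>The splitting \<open>a * c - b * d = a * (c - d) + (a - b) * d\<close> explains why
  integrality is asked of \<open>a\<close> and \<open>d\<close>.\<close>

lemma padic_cong_mult:
  assumes "padic_cong 1 a b" "padic_cong 1 c d" "a \<in> padic_Ints" "d \<in> padic_Ints"
  shows "padic_cong 1 (a * c) (b * d)"
proof -
  from assms obtain u v where uv: "u \<in> padic_Ints" "a - b = of_nat CARD('a) * u"
    "v \<in> padic_Ints" "c - d = of_nat CARD('a) * v"
    unfolding padic_cong_1_iff by blast
  have "a * c - b * d = a * (c - d) + (a - b) * d"
    by (simp add: algebra_simps)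
  also have "\<dots> = of_nat CARD('a) * (a * v + u * d)"
    unfolding uv by (simp add: algebra_simps)
  finally have "a * c - b * d = of_nat CARD('a) * (a * v + u * d)" .
  moreover have "a * v + u * d \<in> padic_Ints"
    using uv assms by (intro padic_Ints_add padic_Ints_mult)
  ultimately show ?thesis
    unfolding padic_cong_1_iff by blast
qed

lemma padic_cong_sum:
  "(\<And>i. i \<in> A \<Longrightarrow> padic_cong 1 (f i) (g i)) \<Longrightarrow> padic_cong 1 (sum f A) (sum g A)"
  by (induction A rule: infinite_finite_induct) (auto intro: padic_cong_add padic_cong_refl simp del: One_nat_def)

lemma padic_cong_prod:
  "(\<And>i. i \<in> A \<Longrightarrow> padic_cong 1 (f i) (g i)) \<Longrightarrow> (\<And>i. i \<in> A \<Longrightarrow> f i \<in> padic_Ints) \<Longrightarrow>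
   (\<And>i. i \<in> A \<Longrightarrow> g i \<in> padic_Ints) \<Longrightarrow> padic_cong 1 (prod f A) (prod g A)"
  by (induction A rule: infinite_finite_induct)
    (auto intro!: padic_cong_mult padic_Ints_prod padic_cong_refl simp del: One_nat_def)

lemma padic_cong_power:
  "padic_cong 1 a b \<Longrightarrow> a \<in> padic_Ints \<Longrightarrow> b \<in> padic_Ints \<Longrightarrow> padic_cong 1 (a ^ n) (b ^ n)"
  by (induction n) (auto intro: padic_cong_mult padic_Ints_power padic_cong_refl simp del: One_nat_def)

text \<open>This transfers the integer congruences above to the \<open>p\<close>-adic numbers. The
  direction from left to right descends from the fraction field to the inverse limit and compares
  entries at level \<open>1\<close>, where multiples of \<open>p\<close> are
  \<open>0\<close>.\<close>

lemma padic_cong_of_int_iff: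
  "padic_cong 1 (of_int a) (of_int b :: 'p::prime_card padic) \<longleftrightarrow> [a = b] (mod int CARD('p))"
proof
  assume "[a = b] (mod int CARD('p))"
  then obtain c where "a - b = int CARD('p) * c"
    by (metis cong_iff_dvd_diff dvdE)
  then have "of_int a - of_int b = (of_nat CARD('p) * of_int c :: 'p padic)"
    by (metis of_int_diff of_int_mult of_int_of_nat_eq)
  then show "padic_cong 1 (of_int a) (of_int b :: 'p padic)"
    unfolding padic_cong_1_iff using padic_Ints_of_int by blast
next
  let ?p = "int CARD('p)"
  have nat_case: "int n mod ?p = 0" if "of_nat n = (of_nat CARD('p) * to_fract c :: 'p padic)" for n c
  proof -
    have to_fract_nat: "of_nat k = to_fract (of_nat k :: 'p padic_int)" for k
      by (induction k) simp_all
    have "of_nat n = of_nat CARD('p) * c"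
      using that unfolding to_fract_nat by (simp flip: to_fract_mult)
    then have "padic_residue (of_nat n :: 'p padic_int) 1 = padic_residue (of_nat CARD('p) * c) 1"
      by simp
    then show ?thesis
      by (simp add: times_padic_int.rep_eq padic_residue_of_nat)
  qed
  assume "padic_cong 1 (of_int a) (of_int b :: 'p padic)"
  then obtain c where c: "of_int (a - b) = (of_nat CARD('p) * to_fract c :: 'p padic)"
    unfolding padic_cong_1_iff padic_Ints_def by auto
  show "[a = b] (mod ?p)"
  \<comment> \<open>The entries are known for natural numbers, so a negative difference is negated
    first.\<close>
  proof (cases "a - b \<ge> 0")
    case True
    then have "of_nat (nat (a - b)) = (of_nat CARD('p) * to_fract c :: 'p padic)"
      using c by simp
    from nat_case[OF this] True show ?thesis
      by (simp add: cong_iff_dvd_diff mod_eq_0_iff_dvd)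
  next
    case False
    then have "of_nat (nat (b - a)) = (of_nat CARD('p) * to_fract (- c) :: 'p padic)"
      using c by (simp add: algebra_simps)
    from nat_case[OF this] False show ?thesis
      by (simp add: cong_iff_dvd_diff mod_eq_0_iff_dvd dvd_diff_commute)
  qed
qed

lemma padic_cong_of_nat_iff:
  "padic_cong 1 (of_nat a) (of_nat b :: 'p::prime_card padic) \<longleftrightarrow> [a = b] (mod CARD('p))"
  using padic_cong_of_int_iff[of "int a" "int b", where 'p = 'p] by (simp add: cong_int_iff)

text \<open>Inverses of \<open>c\<close> exist modulo every \<open>p ^ n\<close> and are unique
  there, so their reduced representatives form a coherent sequence.\<close>

lemma inverse_of_nat_in_padic_Ints:
  assumes "coprime c CARD('p)"
  shows "inverse (of_nat c) \<in> (padic_Ints :: 'p::prime_card padic set)"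
proof -
  let ?p = "int CARD('p)"
  have cop: "coprime (int c) (?p ^ n)" for n
    using assms by simp
  have "\<forall>n. \<exists>g. [int c * g = 1] (mod ?p ^ n)"
    using cong_solve_coprime_int[OF cop] by blast
  then obtain g where g: "\<And>n. [int c * g n = 1] (mod ?p ^ n)"
    by metis
  define f where "f n = g n mod ?p ^ n" for n
  have coh: "f (Suc n) mod ?p ^ n = f n" for n
  proof -
    have "[int c * g (Suc n) = 1] (mod ?p ^ n)"
      using g[of "Suc n"] by (rule cong_dvd_modulus) simp
    then have "[int c * g (Suc n) = int c * g n] (mod ?p ^ n)"
      using g[of n] by (metis cong_sym cong_trans)
    \<comment> \<open>Both are inverses of \<open>c\<close> modulo \<open>?p ^ n\<close>, so
      \<open>c\<close> may be cancelled.\<close>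
    then have "[g (Suc n) = g n] (mod ?p ^ n)"
      using cong_mult_lcancel[OF cop] by blast
    then show ?thesis
      unfolding f_def mod_power_Suc_mod by (simp add: cong_def)
  qed
  have "f \<in> {f. \<forall>n. f n \<in> {0..<?p ^ n} \<and> f (Suc n) mod ?p ^ n = f n}"
    using coh prime_card_power_pos[where 'p = 'p] by (auto simp: f_def)
  then have rep: "padic_residue (Abs_padic_int f :: 'p padic_int) = f"
    by (rule Abs_padic_int_inverse)
  have "of_nat c * (Abs_padic_int f :: 'p padic_int) = 1"
  proof (rule padic_residue_inject[THEN iffD1], rule ext)
    fix n
    show "padic_residue (of_nat c * (Abs_padic_int f :: 'p padic_int)) n =
          padic_residue (1 :: 'p padic_int) n"
      using g[of n]
      by (simp add: times_padic_int.rep_eq one_padic_int.rep_eq padic_residue_of_nat rep f_def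
          mod_simps cong_def)
  qed
  then have "to_fract (of_nat c) * to_fract (Abs_padic_int f :: 'p padic_int) = 1"
    by (metis to_fract_1 to_fract_mult)
  moreover have "to_fract (of_nat c :: 'p padic_int) = of_nat c"
    by (induction c) simp_all
  ultimately have "inverse (of_nat c) = to_fract (Abs_padic_int f :: 'p padic_int)"
    by (metis inverse_unique)
  then show ?thesis
    unfolding padic_Ints_def by simp
qed

lemma inverse_fact_in_padic_Ints:
  assumes "k < CARD('p)"
  shows "inverse (fact k) \<in> (padic_Ints :: 'p::prime_card padic set)"
proof -
  have "\<not> CARD('p) dvd fact k"
    using assms prime_card[where 'a = 'p] by (simp add: prime_dvd_fact_iff)
  then have "coprime (fact k) CARD('p)"
    using prime_card[where 'a = 'p] by (metis coprime_commute prime_imp_coprime)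
  from inverse_of_nat_in_padic_Ints[OF this] show ?thesis
    by simp
qed

lemma gbinomial_in_padic_Ints:
  fixes x :: "'p::prime_card padic"
  assumes "k < CARD('p)" "x \<in> padic_Ints"
  shows "x gchoose k \<in> padic_Ints"
  unfolding gbinomial_prod_rev divide_inverse using assms
  by (intro padic_Ints_mult padic_Ints_prod padic_Ints_diff inverse_fact_in_padic_Ints) auto

text \<open>For \<open>k < p\<close> the denominator \<open>fact k\<close> is a unit, so the
  congruence of the numerators, which are products of \<open>k\<close> factors, survives the
  division.\<close>

lemma gbinomial_padic_cong:
  fixes x y :: "'p::prime_card padic"
  assumes "k < CARD('p)" "x \<in> padic_Ints" "y \<in> padic_Ints" "padic_cong 1 x y"
  shows "padic_cong 1 (x gchoose k) (y gchoose k)"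
proof -
  have "padic_cong 1 (x - of_nat i) (y - of_nat i)" for i
    using padic_cong_add[OF assms(4) padic_cong_refl, of "- of_nat i"] by simp
  then show ?thesis
    unfolding gbinomial_prod_rev divide_inverse using assms
    by (intro padic_cong_mult padic_cong_prod padic_Ints_prod padic_Ints_diff
        inverse_fact_in_padic_Ints padic_cong_refl) auto
qed

lemma D_poly_in_padic_Ints:
  fixes x y :: "'p::prime_card padic"
  assumes "n < CARD('p)" "x \<in> padic_Ints" "y \<in> padic_Ints"
  shows "D_poly n x y \<in> padic_Ints"
  unfolding D_poly_def using assms
  by (intro padic_Ints_sum padic_Ints_mult padic_Ints_power gbinomial_in_padic_Ints) auto

lemma D_poly_padic_cong:
  fixes x y x' y' :: "'p::prime_card padic"
  assumes "n < CARD('p)" "x \<in> padic_Ints" "y \<in> padic_Ints" "x' \<in> padic_Ints" "y' \<in> padic_Ints"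
    and "padic_cong 1 x x'" "padic_cong 1 y y'"
  shows "padic_cong 1 (D_poly n x y) (D_poly n x' y')"
  unfolding D_poly_def using assms
  by (intro padic_cong_sum padic_cong_mult padic_Ints_mult padic_Ints_power gbinomial_in_padic_Ints
      gbinomial_padic_cong padic_cong_power padic_cong_refl) auto

text \<open>The entry at level \<open>1\<close> of the coherent sequence serves as \<open>r\<close>;
  the work lies in building the \<open>p\<close>-adic integer \<open>(x - r) / p\<close>.\<close>

lemma ex_padic_cong_of_nat:
  fixes x :: "'p::prime_card padic"
  assumes "x \<in> padic_Ints"
  obtains r where "r < CARD('p)" "padic_cong 1 x (of_nat r)"
proof -
  let ?p = "int CARD('p)"
  obtain z where z: "x = to_fract z"
    using assms unfolding padic_Ints_def by auto
  define r where "r = nat (padic_residue z 1)"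
  have res: "padic_residue z n \<in> {0..<?p ^ n}" "padic_residue z (Suc n) mod ?p ^ n = padic_residue z n" for n
    using padic_residue[of z] by auto
  have r: "int r = padic_residue z 1" "int r < ?p"
    using res(1)[of 1] by (auto simp: r_def)
  \<comment> \<open>Division by \<open>?p\<close> costs one power of \<open>?p\<close>, so level
    \<open>n\<close> of the quotient is read off from level \<open>Suc n\<close> of
    \<open>z\<close>.\<close>
  define f where "f n = (padic_residue z (Suc n) - int r) div ?p" for n
  have dv: "padic_residue z (Suc n) - int r = ?p * f n" for n
  proof -
    have "padic_residue z (1 + n) mod ?p ^ 1 = int r mod ?p ^ 1"
      using padic_residue_mod[of z 1 n] r by simp
    then show ?thesis
      by (simp add: f_def mod_eq_dvd_iff)
  qed
  define g where "g n = f n mod ?p ^ n" for n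
  have coh: "g (Suc n) mod ?p ^ n = g n" for n
  proof -
    have "?p ^ Suc n dvd padic_residue z (Suc (Suc n)) - padic_residue z (Suc n)"
      using res(2)[of "Suc n"] by (metis mod_eq_dvd_iff mod_mod_trivial)
    also have "padic_residue z (Suc (Suc n)) - padic_residue z (Suc n) = ?p * (f (Suc n) - f n)"
      using dv[of "Suc n"] dv[of n] by (simp add: algebra_simps)
    finally have "?p ^ n dvd f (Suc n) - f n"
      using prime_card_power_pos[where 'p = 'p, of 1] by simp
    then show ?thesis
      unfolding g_def mod_power_Suc_mod by (simp add: mod_eq_dvd_iff)
  qed
  have "g \<in> {f. \<forall>n. f n \<in> {0..<?p ^ n} \<and> f (Suc n) mod ?p ^ n = f n}"
    using coh prime_card_power_pos[where 'p = 'p] by (auto simp: g_def)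
  then have rep: "padic_residue (Abs_padic_int g :: 'p padic_int) = g"
    by (rule Abs_padic_int_inverse)
  have "z = of_nat r + of_nat CARD('p) * (Abs_padic_int g :: 'p padic_int)"
  proof (rule padic_residue_inject[THEN iffD1], rule ext)
    fix n
    have "[?p * g n = ?p * f n] (mod ?p ^ n)"
      by (intro cong_mult cong_refl) (simp add: g_def cong_def)
    then have "[int r + ?p * g n = int r + ?p * f n] (mod ?p ^ n)"
      by (intro cong_add cong_refl)
    moreover have "int r + ?p * f n = padic_residue z (Suc n)"
      using dv[of n] by simp
    ultimately show "padic_residue z n =
        padic_residue (of_nat r + of_nat CARD('p) * (Abs_padic_int g :: 'p padic_int)) n"
      using res(2)[of n]
      by (simp add: times_padic_int.rep_eq plus_padic_int.rep_eq padic_residue_of_nat rep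
          mod_simps cong_def)
  qed
  then have "x = to_fract (of_nat r) + to_fract (of_nat CARD('p)) * to_fract (Abs_padic_int g)"
    unfolding z by (metis to_fract_add to_fract_mult)
  moreover have "to_fract (of_nat k :: 'p padic_int) = of_nat k" for k
    by (induction k) simp_all
  ultimately have "padic_cong 1 x (of_nat r)"
    unfolding padic_cong_1_iff padic_Ints_def by auto
  with r(2) show ?thesis
    by (intro that) auto
qed

lemma least_residue_eq:
  fixes x :: "'p::prime_card padic"
  assumes "r < CARD('p)" "padic_cong 1 x (of_nat r)"
  shows "least_residue x = r"
  unfolding least_residue_def
proof (rule Least_equality)
  fix q assume "padic_cong 1 x (of_nat q)"
  then have "[r = q] (mod CARD('p))"
    using assms(2) padic_cong_of_nat_iff padic_cong_sym padic_cong_trans by blast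
  then show "r \<le> q"
    using assms(1) by (metis cong_def mod_less mod_less_eq_dividend)
qed fact

section \<open>Reduction of the three \<open>p\<close>-adic sums to the integer congruences\<close>

theorem theorem1p1:
  fixes x y :: "'p::prime_card padic"
  assumes "x \<in> padic_Ints" and "y \<in> padic_Ints" and "\<not> padic_cong 1 y 0"
  shows "padic_cong 1
           (\<Sum>k=0..CARD('p) - 1. D_poly k x y * D_poly k (- 1 - x) y)
           ((- 1) ^ least_residue x)
       \<and> (\<not> padic_cong 1 y 1 \<longrightarrow>
           padic_cong 1
             (\<Sum>k=0..CARD('p) - 1. (1 - y) ^ k * D_poly k x y * D_poly k x (y / (y - 1)))
             ((- 1) ^ least_residue x))
       \<and> (CARD('p) \<noteq> 2 \<longrightarrow>
           padic_cong 1
             (\<Sum>k=0..CARD('p) - 1. (S_poly k x y)\<^sup>2)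
             (if padic_cong 1 x (- 1 / 2) then of_int (Legendre (- 1) (int CARD('p))) else 0))"
proof -
  let ?p = "CARD('p)"
  have p: "prime ?p" by (rule prime_card)
  have p1: "?p > 1" using p by (rule prime_gt_1_nat)
  obtain r where r: "r < ?p" "padic_cong 1 x (of_nat r)"
    using ex_padic_cong_of_nat[OF assms(1)] by blast
  obtain t where t: "padic_cong 1 y (of_nat t)"
    using ex_padic_cong_of_nat[OF assms(2)] by blast
  \<comment> \<open>This is the least residue of \<open>- 1 - x\<close>.\<close>
  define s where "s = ?p - 1 - r"
  have rs: "r + s = ?p - 1"
    using r(1) by (simp add: s_def)
  have "\<not> ?p dvd t"
  proof
    assume "?p dvd t"
    then have "padic_cong 1 (of_nat t) (of_nat 0 :: 'p padic)"
      unfolding padic_cong_of_nat_iff by (simp add: cong_0_iff)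
    with t assms(3) show False
      using padic_cong_trans[of y "of_nat t" 0] by simp
  qed
  have x': "- 1 - x \<in> padic_Ints"
    using assms(1) by (intro padic_Ints_diff padic_Ints_uminus) auto
  have s: "padic_cong 1 (- 1 - x) (of_nat s)"
  proof -
    obtain c where c: "c \<in> padic_Ints" "x - of_nat r = of_nat ?p * c"
      using r(2) unfolding padic_cong_1_iff by blast
    have "r + s + 1 = ?p" using rs p1 by simp
    then have "of_nat r + of_nat s + 1 = (of_nat ?p :: 'p padic)"
      by (metis of_nat_1 of_nat_add)
    \<comment> \<open>The left-hand side equals \<open>- (x - r) - (r + s + 1)\<close>.\<close>
    then have "- 1 - x - of_nat s = of_nat ?p * (- c - 1)"
      using c(2) by (simp add: algebra_simps)
    moreover have "- c - 1 \<in> padic_Ints"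
      using c(1) by (intro padic_Ints_diff padic_Ints_uminus) auto
    ultimately show ?thesis
      unfolding padic_cong_1_iff by blast
  qed
  \<comment> \<open>This bound makes every factorial in the denominators a \<open>p\<close>-adic
    unit.\<close>
  have lt: "k < ?p" if "k \<in> {0..?p - 1}" for k
    using that p1 by auto

  have first: "padic_cong 1 (\<Sum>k=0..?p - 1. D_poly k x y * D_poly k (- 1 - x) y)
      ((- 1) ^ least_residue x)"
  proof -
    have "padic_cong 1 (\<Sum>k=0..?p - 1. D_poly k x y * D_poly k (- 1 - x) y)
        (\<Sum>k=0..?p - 1. D_poly k (of_nat r) (of_nat t) * D_poly k (of_nat s) (of_nat t))"
      using lt assms(1,2) x' r(2) s t
      by (intro padic_cong_sum padic_cong_mult D_poly_padic_cong D_poly_in_padic_Ints) auto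
    also have "(\<Sum>k=0..?p - 1. D_poly k (of_nat r) (of_nat t) * D_poly k (of_nat s) (of_nat t)) =
        (of_int (\<Sum>n=0..?p - 1. (\<Sum>j\<le>r. int (r choose j) * int t ^ j * int (n choose j)) *
                          (\<Sum>k\<le>s. int (s choose k) * int t ^ k * int (n choose k))) :: 'p padic)"
      unfolding D_poly_of_nat by simp
    also have "padic_cong 1 \<dots> (of_int ((- 1) ^ r))"
      unfolding padic_cong_of_int_iff using p rs \<open>\<not> ?p dvd t\<close> by (rule sum_int_D_cong)
    finally show ?thesis
      using least_residue_eq[OF r] by simp
  qed

  have second: "padic_cong 1
      (\<Sum>k=0..?p - 1. (1 - y) ^ k * D_poly k x y * D_poly k x (y / (y - 1)))
      ((- 1) ^ least_residue x)" if "\<not> padic_cong 1 y 1"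
  proof -
    have "y \<noteq> 1"
      using that padic_cong_refl by metis
    from D_poly_Pfaff[OF this]
    have "(1 - y) ^ k * D_poly k x y * D_poly k x (y / (y - 1)) =
        D_poly k x y * D_poly k (- 1 - x) y" for k
      by (metis mult.assoc mult.commute)
    then show ?thesis
      using first by (simp only:)
  qed

  have third: "padic_cong 1 (\<Sum>k=0..?p - 1. (S_poly k x y)\<^sup>2)
      (if padic_cong 1 x (- 1 / 2) then of_int (Legendre (- 1) (int ?p)) else 0)" if "?p \<noteq> 2"
  proof -
    \<comment> \<open>As \<open>p\<close> is odd, \<open>1 / 2\<close> is a \<open>p\<close>-adic
      integer and the condition becomes \<open>p dvd 2 * r + 1\<close>, which by size means
      \<open>2 * r + 1 = p = r + s + 1\<close>.\<close>
    have half: "padic_cong 1 x (- 1 / 2) \<longleftrightarrow> r = s"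
    proof -
      have "coprime 2 ?p"
        using p that by (metis primes_coprime two_is_prime_nat)
      then have inv2: "inverse (of_nat 2) \<in> (padic_Ints :: 'p padic set)"
        by (rule inverse_of_nat_in_padic_Ints)
      then have inv2': "inverse 2 \<in> (padic_Ints :: 'p padic set)"
        by simp
      have "- 1 / 2 = (- inverse 2 :: 'p padic)"
        by (simp add: field_simps)
      then have half_int: "- 1 / 2 \<in> (padic_Ints :: 'p padic set)"
        using inv2' by (simp add: padic_Ints_uminus)
      have "padic_cong 1 x (- 1 / 2) \<longleftrightarrow> padic_cong 1 (of_nat r) (- 1 / 2 :: 'p padic)"
        using r(2) padic_cong_sym padic_cong_trans by blast
      also have "\<dots> \<longleftrightarrow> padic_cong 1 (of_int (2 * int r)) (of_int (- 1) :: 'p padic)"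
      proof
        assume "padic_cong 1 (of_nat r) (- 1 / 2 :: 'p padic)"
        then have "padic_cong 1 (2 * of_nat r) (2 * (- 1 / 2) :: 'p padic)"
          using half_int padic_Ints_of_nat[of 2, where 'a = 'p]
          by (intro padic_cong_mult padic_cong_refl) auto
        then show "padic_cong 1 (of_int (2 * int r)) (of_int (- 1) :: 'p padic)"
          by simp
      next
        assume "padic_cong 1 (of_int (2 * int r)) (of_int (- 1) :: 'p padic)"
        then have "padic_cong 1 (inverse 2 * of_int (2 * int r)) (inverse 2 * of_int (- 1) :: 'p padic)"
          using inv2' by (intro padic_cong_mult padic_cong_refl padic_Ints_of_int)
        then show "padic_cong 1 (of_nat r) (- 1 / 2 :: 'p padic)"
          by (simp add: field_simps)
      qed
      also have "\<dots> \<longleftrightarrow> ?p dvd 2 * r + 1"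
      proof -
        have "2 * int r - (- 1) = int (2 * r + 1)" by simp
        then show ?thesis
          unfolding padic_cong_of_int_iff cong_iff_dvd_diff by (metis of_nat_dvd_iff)
      qed
      also have "\<dots> \<longleftrightarrow> r = s"
      proof
        assume "?p dvd 2 * r + 1"
        then obtain c where c: "2 * r + 1 = ?p * c" by (elim dvdE)
        \<comment> \<open>From \<open>r < p\<close> follows \<open>2 * r + 1 < 2 * p\<close>,
          leaving \<open>c = 1\<close> as the only positive multiplier.\<close>
        have "?p * c < ?p * 2" using c r(1) by linarith
        then have "c < 2" by simp
        moreover have "c \<noteq> 0" using c by (intro notI) simp
        ultimately have "c = 1" by simp
        with c rs show "r = s" by simp
      next
        assume "r = s"
        then have "2 * r + 1 = ?p" using rs p1 by simp
        then show "?p dvd 2 * r + 1" by simp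
      qed
      finally show ?thesis .
    qed
    have S: "padic_cong 1 (S_poly k x y)
        (of_int (\<Sum>j\<le>min r s. int (r choose j) * int (s choose j) * int t ^ j * int (k choose j)))"
      if "k < ?p" for k
    proof -
      have "padic_cong 1 (S_poly k x y)
          (\<Sum>i=0..k. of_nat (k choose i) * ((of_nat r gchoose i) * (of_nat s gchoose i) * of_nat t ^ i))"
        unfolding S_poly_eq_combination using that assms(1,2) x' r(2) s t
        by (intro padic_cong_sum padic_cong_mult padic_Ints_mult padic_Ints_power
            gbinomial_in_padic_Ints gbinomial_padic_cong padic_cong_power padic_cong_refl) auto
      then show ?thesis
        unfolding binomial_gbinomial[symmetric] sum_binomial_products_restrict .
    qed
    have S_int: "S_poly k x y \<in> padic_Ints" if "k < ?p" for k
      unfolding S_poly_def using that assms(1,2) x'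
      by (intro padic_Ints_sum padic_Ints_mult padic_Ints_power gbinomial_in_padic_Ints) auto
    have "padic_cong 1 (\<Sum>k=0..?p - 1. (S_poly k x y)\<^sup>2)
        (\<Sum>k=0..?p - 1. (of_int
          (\<Sum>j\<le>min r s. int (r choose j) * int (s choose j) * int t ^ j * int (k choose j)))\<^sup>2)"
      by (intro padic_cong_sum padic_cong_power S S_int lt padic_Ints_of_int)
    also have "\<dots> = of_int (\<Sum>n=0..?p - 1.
          (\<Sum>j\<le>min r s. int (r choose j) * int (s choose j) * int t ^ j * int (n choose j))\<^sup>2)"
      by simp
    also have "padic_cong 1 \<dots> (of_int (if r = s then Legendre (- 1) (int ?p) else 0) :: 'p padic)"
      unfolding padic_cong_of_int_iff
      using p that rs \<open>\<not> ?p dvd t\<close> by (rule sum_int_S_square_cong)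
    finally show ?thesis
      using half by (simp split: if_splits)
  qed

  show ?thesis
    using first second third by blast
qed

end
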